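(* Let $n \geq 1$ be an integer and let $F_{2n} : \mathbb{C} \to \mathbb{C}$ be the entire function $$F_{2n}(z) = \int_{-\infty}^{\infty} e^{-t^{2n}} e^{izt}\, dt .$$ Then all the zeros of $F_{2n}$ are simple; that is, whenever $z_0\in\mathbb{C}$ satisfies $F_{2n}(z_0)=0$, one has $F_{2n}'(z_0)\neq 0$.
   Context: It is a known theorem of Pólya (1923) that for every integer $n \geq 1$ all zeros of $F_{2n}$ (if any) lie on the real line, and that for $n \geq 2$ there are infinitely many of them; for $n=1$ one has $F_2(z)=\sqrt{\pi}\,e^{-z^2/4}$, which has no zeros. *)

theory Defs
  imports "HOL-Analysis.Analysis"
begin

(* Meaningful for even m \<ge> 2 only: there the integrand is integrable for every complex z.
   Elsewhere the integral may take Isabelle's default value 0. *)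
definition polya_F :: "nat \<Rightarrow> complex \<Rightarrow> complex" where
  "polya_F m z = (LINT t|lborel. exp (- (complex_of_real t ^ m)) * exp (\<i> * z * complex_of_real t))"

end

theory Submission
  imports
    Defs
    "HOL-Computational_Algebra.Fundamental_Theorem_Algebra"
    "HOL-Complex_Analysis.Complex_Analysis"
    "HOL-Probability.Distributions"
    "HOL-Real_Asymp.Real_Asymp"
begin

text \<open>
  Write $F = F_{2n}$. Its Taylor coefficients are values of the Gamma function, and Euler's limit
  formula turns them into limits of the coefficients of
  $K_N \prod_{r=1}^{n-1} \prod_{i=0}^{N} (z\,d/dz + 1 + 2r + 2ni) (1 - \sigma_N z^2)^N$. The operators
  $z\,d/dz + a$ with $a > 0$ preserve real-rootedness, so $F$ is a locally uniform limit of real-rooted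
  polynomials; hence all zeros of $F$ are real.

  Integration by parts gives $F^{(2n-1)}(z) = (-1)^n z F(z) / (2n)$. At a double zero $x$ of $F$ this
  makes $F^{(2n-1)}$ and $F^{(2n)}$ vanish. Every derivative $G$ of $F$ is again a limit of real-rooted
  polynomials, and for nonconstant $G$ the equations $G'(x) = G''(x) = 0$ force $G(x) = 0$. Descending, all
  derivatives of order at most $2n$ vanish at $x$; by the differential equation all derivatives do,
  so $F = 0$, contradicting $F(0) > 0$.
\<close>

subsection \<open>Real-rooted polynomials\<close>

text \<open>The zero polynomial is included so that the class is closed under differentiation.\<close>

definition real_rooted :: "complex poly \<Rightarrow> bool" where
  "real_rooted p \<longleftrightarrow> p = 0 \<or> (\<forall>z. poly p z = 0 \<longrightarrow> z \<in> \<real>)"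

text \<open>The fundamental theorem of algebra splits \<open>p\<close> into linear factors with real
  roots, so estimates that are multiplicative over factors can be proved one factor at a
  time.\<close>

lemma real_rooted_induct [consumes 1, case_names const linear]:
  assumes "real_rooted p"
    and const: "\<And>c. P [:c:]"
    and linear: "\<And>r p. p \<noteq> 0 \<Longrightarrow> P p \<Longrightarrow> P ([:- complex_of_real r, 1:] * p)"
  shows "P p"
proof (cases "p = 0")
  case True
  then show ?thesis using const[of 0] by simp
next
  case False
  define c where "c = lead_coeff p"
  have "c \<noteq> 0" using False by (simp add: c_def)
  have "P (smult c (\<Prod>x\<in>#A. [:-x, 1:]))" if "\<forall>x\<in>#A. x \<in> \<real>" for A
    using that
  proof (induction A)
    case empty
    then show ?case using const[of c] by simp
  next
    case (add x A)
    obtain r where r: "x = of_real r" using add.prems by (auto elim: Reals_cases)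
    have "(\<Prod>x\<in>#A. [:-x, 1:]) \<noteq> 0" by (auto simp: prod_mset_zero_iff)
    then show ?case
      using linear[of "smult c (\<Prod>x\<in>#A. [:-x, 1:])" r] add \<open>c \<noteq> 0\<close>
      by (simp add: r mult.commute)
  qed
  moreover have "\<forall>x\<in>#proots p. x \<in> \<real>"
    using assms(1) False by (auto simp: real_rooted_def)
  ultimately have "P (smult c (\<Prod>x\<in>#proots p. [:-x, 1:]))" by blast
  then show ?thesis unfolding c_def complex_poly_decompose_multiset .
qed

text \<open>On a vertical line, the distance to a real root \<open>r\<close> grows with the distance
  to the real axis; this holds factor by factor.\<close>

lemma real_rooted_norm_mono:
  assumes "real_rooted p" "\<bar>s\<bar> \<le> \<bar>y\<bar>"
  shows "cmod (poly p (Complex x s)) \<le> cmod (poly p (Complex x y))"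
  using assms(1)
proof (induction rule: real_rooted_induct)
  case (linear r p)
  have "s\<^sup>2 \<le> y\<^sup>2" using assms(2) by (simp add: abs_le_square_iff)
  then have "cmod (Complex x s - of_real r) \<le> cmod (Complex x y - of_real r)"
    by (simp add: cmod_def)
  then show ?case using linear
    by (simp add: norm_mult mult_mono del: mult_pCons_left)
qed auto

text \<open>If the roots are r_i, then p'/p is the sum of 1/(x - r_i), and (p'/p)^2 - p''/p =
  -(p'/p)' is the sum of 1/(x - r_i)^2. Both parts of the exponent are therefore additive over
  linear factors, and each factor is handled by 1 + u <= exp u.\<close>

lemma real_rooted_norm_bound:
  fixes x :: real and w :: complex
  assumes "real_rooted p" "poly p x \<noteq> 0"
  shows "(cmod (poly p (x + w)))\<^sup>2 \<le> (cmod (poly p x))\<^sup>2 *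
    exp (2 * Re (w * (poly (pderiv p) x / poly p x)) +
         (cmod w)\<^sup>2 * Re ((poly (pderiv p) x / poly p x)\<^sup>2 - poly (pderiv (pderiv p)) x / poly p x))"
  using assms
proof (induction rule: real_rooted_induct)
  case (linear r p)
  let ?l = "[:- complex_of_real r, 1:]"
  define y where "y = 1 / (x - r)"
  define E where "E = poly (pderiv p) x / poly p x"
  define D where "D = poly (pderiv (pderiv p)) x / poly p x"
  have nz: "poly p x \<noteq> 0" "x \<noteq> r" using linear.prems by auto
  have IH: "(cmod (poly p (x + w)))\<^sup>2 \<le> (cmod (poly p x))\<^sup>2 * exp (2 * Re (w * E) + (cmod w)\<^sup>2 * Re (E\<^sup>2 - D))"
    using linear.IH nz by (simp add: E_def D_def)
  have d1: "pderiv (?l * p) = p + ?l * pderiv p"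
    by (simp only: pderiv_mult pderiv_pCons) simp
  have d2: "pderiv (pderiv (?l * p)) = 2 * pderiv p + ?l * pderiv (pderiv p)"
    unfolding d1 by (simp only: pderiv_add pderiv_mult pderiv_pCons) simp
  have xr: "complex_of_real x - of_real r \<noteq> 0" using nz by simp
  have e1: "poly (pderiv (?l * p)) x / poly (?l * p) x = y + E"
    unfolding d1 poly_add poly_mult y_def E_def using nz xr by (simp add: field_simps)
  have e2: "poly (pderiv (pderiv (?l * p))) x / poly (?l * p) x = 2 * of_real y * E + D"
    unfolding d2 poly_add poly_mult y_def E_def D_def using nz xr by (simp add: field_simps)
  have e3: "(of_real y + E)\<^sup>2 - (2 * of_real y * E + D) = of_real (y\<^sup>2) + (E\<^sup>2 - D)"
    by (simp add: power2_eq_square algebra_simps)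
  \<comment> \<open>Since \<open>y\<close> is real, the square expands exactly into 1 plus the
    exponent belonging to this factor.\<close>
  have "cmod (1 + w * y) ^ 2 = 1 + (2 * Re (w * y) + (cmod w)\<^sup>2 * y\<^sup>2)"
    unfolding cmod_power2 by (simp add: power2_eq_square algebra_simps)
  also have "\<dots> \<le> exp (2 * Re (w * y) + (cmod w)\<^sup>2 * y\<^sup>2)" by (rule exp_ge_add_one_self)
  finally have l: "cmod (1 + w * y) ^ 2 \<le> exp (2 * Re (w * y) + (cmod w)\<^sup>2 * y\<^sup>2)" .
  have "poly ?l (x + w) = poly ?l x * (1 + w * y)"
    using xr by (simp add: y_def field_simps)
  then have "(cmod (poly (?l * p) (x + w)))\<^sup>2 = (cmod (poly ?l x))\<^sup>2 * (cmod (1 + w * y)) ^ 2 * (cmod (poly p (x + w)))\<^sup>2"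
    by (simp only: poly_mult norm_mult power_mult_distrib)
  also have "\<dots> \<le> (cmod (poly ?l x))\<^sup>2 * exp (2 * Re (w * y) + (cmod w)\<^sup>2 * y\<^sup>2) *
     ((cmod (poly p x))\<^sup>2 * exp (2 * Re (w * E) + (cmod w)\<^sup>2 * Re (E\<^sup>2 - D)))"
    by (intro mult_mono l IH order_refl) auto
  also have "\<dots> = (cmod (poly (?l * p) x))\<^sup>2 *
     (exp (2 * Re (w * y) + (cmod w)\<^sup>2 * y\<^sup>2) * exp (2 * Re (w * E) + (cmod w)\<^sup>2 * Re (E\<^sup>2 - D)))"
    by (simp only: poly_mult norm_mult power_mult_distrib mult_ac)
  also have "exp (2 * Re (w * y) + (cmod w)\<^sup>2 * y\<^sup>2) * exp (2 * Re (w * E) + (cmod w)\<^sup>2 * Re (E\<^sup>2 - D)) =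
     exp (2 * Re (w * (y + E)) + (cmod w)\<^sup>2 * Re ((of_real y + E)\<^sup>2 - (2 * of_real y * E + D)))"
    unfolding e3 exp_add [symmetric] by (simp add: algebra_simps)
  finally show ?case unfolding e1 e2 .
qed auto

text \<open>The logarithmic derivative is a sum of terms 1/(z - r) with \<open>r\<close> real, and
  the imaginary part of each has the sign opposite to that of \<open>Im z\<close>.\<close>

lemma real_rooted_Im_log_deriv:
  assumes "real_rooted p" "p \<noteq> 0" "Im z \<noteq> 0"
  shows "Im z * Im (poly (pderiv p) z / poly p z) \<le> 0"
    and "degree p > 0 \<Longrightarrow> Im z * Im (poly (pderiv p) z / poly p z) < 0"
proof -
  have "p \<noteq> 0 \<longrightarrow> poly p z \<noteq> 0 \<and> Im z * Im (poly (pderiv p) z / poly p z) \<le> 0 \<and>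
      (degree p > 0 \<longrightarrow> Im z * Im (poly (pderiv p) z / poly p z) < 0)"
    using assms(1)
  proof (induction rule: real_rooted_induct)
    case (linear r p)
    let ?l = "[:- complex_of_real r, 1:]"
    have nz: "poly p z \<noteq> 0" "z - of_real r \<noteq> 0"
      using linear assms(3) by (auto simp: complex_eq_iff)
    have "pderiv (?l * p) = p + ?l * pderiv p"
      by (simp only: pderiv_mult pderiv_pCons) simp
    then have eq: "poly (pderiv (?l * p)) z / poly (?l * p) z = 1 / (z - r) + poly (pderiv p) z / poly p z"
      using nz by (simp only: poly_add poly_mult) (simp add: field_simps)
    have "Im z * Im (1 / (z - r)) = - ((Im z)\<^sup>2 / ((Re z - r)\<^sup>2 + (Im z)\<^sup>2))"
      by (simp add: Im_divide power2_eq_square)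
    also have "\<dots> < 0" using assms(3) by (simp add: add_nonneg_pos)
    finally have "Im z * Im (1 / (z - r)) < 0" .
    then have "Im z * Im (poly (pderiv (?l * p)) z / poly (?l * p) z) < 0"
      unfolding eq plus_complex.sel distrib_left using linear by linarith
    then show ?case using nz by (auto simp del: mult_pCons_left)
  qed auto
  with assms(2) show "Im z * Im (poly (pderiv p) z / poly p z) \<le> 0"
    and "degree p > 0 \<Longrightarrow> Im z * Im (poly (pderiv p) z / poly p z) < 0" by auto
qed

text \<open>Gauss-Lucas for the real line: off the real axis the logarithmic derivative of a
  nonconstant \<open>p\<close> has nonzero imaginary part.\<close>

lemma real_rooted_pderiv:
  assumes "real_rooted p"
  shows "real_rooted (pderiv p)"
proof (cases "degree p = 0")
  case True
  then show ?thesis by (simp add: real_rooted_def pderiv_eq_0_iff)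
next
  case False
  then have "p \<noteq> 0" by auto
  have "z \<in> \<real>" if "poly (pderiv p) z = 0" for z
    using real_rooted_Im_log_deriv(2)[OF assms \<open>p \<noteq> 0\<close>, of z] False that
    by (auto simp: complex_is_Real_iff)
  then show ?thesis by (simp add: real_rooted_def)
qed

section \<open>The operators z d/dz + a\<close>

definition theta_shift :: "real \<Rightarrow> complex poly \<Rightarrow> complex poly" where
  "theta_shift a p = smult (of_real a) p + [:0, 1:] * pderiv p"

lemma coeff_theta_shift: "coeff (theta_shift a p) j = of_real (of_nat j + a) * coeff p j"
  by (cases j) (auto simp: theta_shift_def coeff_pderiv algebra_simps)

text \<open>At a nonreal zero of the image, p'/p would equal -a/z. For \<open>a > 0\<close> its
  imaginary part has the sign of \<open>Im z\<close>, against
  \<open>real_rooted_Im_log_deriv\<close>.\<close>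

lemma real_rooted_theta_shift:
  assumes "real_rooted p" "a > 0"
  shows "real_rooted (theta_shift a p)"
proof (cases "p = 0")
  case True
  then show ?thesis by (simp add: real_rooted_def theta_shift_def)
next
  case False
  have "z \<in> \<real>" if 0: "poly (theta_shift a p) z = 0" for z
  proof (rule ccontr)
    assume "z \<notin> \<real>"
    then have z: "Im z \<noteq> 0" "z \<noteq> 0" "poly p z \<noteq> 0"
      using assms(1) False by (auto simp: complex_is_Real_iff real_rooted_def)
    have "poly (pderiv p) z / poly p z = - of_real a / z"
      using 0 z by (simp add: theta_shift_def field_simps add_eq_0_iff)
    moreover have "Im z * Im (- of_real a / z) = a * ((Im z)\<^sup>2 / ((Re z)\<^sup>2 + (Im z)\<^sup>2))"
      by (simp add: Im_divide power2_eq_square)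
    moreover have "\<dots> > 0" using assms(2) z by (simp add: add_nonneg_pos)
    ultimately show False using real_rooted_Im_log_deriv(1)[OF assms(1) False z(1)] by simp
  qed
  then show ?thesis by (simp add: real_rooted_def)
qed

subsection \<open>Limits of real-rooted polynomials\<close>

lemma poly_sums: "(\<lambda>j. coeff p j * z ^ j) sums poly p z" for z :: "'a::real_normed_field"
proof -
  have "(\<lambda>j. coeff p j * z ^ j) sums (\<Sum>j\<le>degree p. coeff p j * z ^ j)"
    by (rule sums_finite) (auto simp: coeff_eq_0)
  then show ?thesis by (simp add: poly_altdef)
qed

lemma deriv_poly: "deriv (poly p) = poly (pderiv p)"
  for p :: "'a::real_normed_field poly"
  by (intro ext DERIV_imp_deriv poly_DERIV)

lemma higher_deriv_poly: "(deriv ^^ n) (poly p) = poly ((pderiv ^^ n) p)"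
  for p :: "'a::real_normed_field poly"
  by (induction n) (simp_all add: deriv_poly)

section \<open>From coefficientwise to locally uniform convergence\<close>

lemma coeff_norm_le_of_norm_le:
  fixes p :: "complex poly"
  assumes "r > 0" "\<And>z. cmod z = r \<Longrightarrow> cmod (poly p z) \<le> B"
  shows "cmod (coeff p n) \<le> B / r ^ n"
proof -
  have "cmod ((deriv ^^ n) (poly p) 0) \<le> fact n * B / r ^ n"
    using assms by (intro Cauchy_inequality) (auto intro!: holomorphic_intros continuous_intros)
  moreover have "(deriv ^^ n) (poly p) 0 = fact n * coeff p n"
    by (simp add: higher_deriv_poly poly_0_coeff_0 coeff_higher_pderiv pochhammer_fact)
  ultimately show ?thesis using assms(1) by (simp add: norm_mult field_simps)
qed

text \<open>Only coefficientwise convergence is assumed; locally uniform convergence is derived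
  below from real-rootedness. The condition \<open>a 0 \<noteq> 0\<close> lets
  \<open>real_rooted_norm_bound\<close> be applied at 0 and excludes f = 0.\<close>

locale real_rooted_limit =
  fixes p :: "nat \<Rightarrow> complex poly" and a :: "nat \<Rightarrow> complex" and f :: "complex \<Rightarrow> complex"
  assumes real_rooted: "real_rooted (p m)"
    and coeff_tendsto: "(\<lambda>m. coeff (p m) j) \<longlonglongrightarrow> a j"
    and a0: "a 0 \<noteq> 0"
    and f_sums: "(\<lambda>j. a j * z ^ j) sums f z"
begin

lemma holomorphic: "f holomorphic_on S"
proof (rule holomorphic_on_subset)
  have "f holomorphic_on ball 0 r" for r
    by (rule power_series_holomorphic[where a = a]) (simp add: f_sums)
  then have "f field_differentiable at z" for z
    by (rule holomorphic_on_imp_differentiable_at[of _ "ball 0 (cmod z + 1)"]) auto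
  then show "f holomorphic_on UNIV" by (simp add: holomorphic_on_def)
qed simp

text \<open>By \<open>real_rooted_norm_bound\<close> at $0$, the first three coefficients of a real-rooted polynomial
  control its growth.\<close>

lemma locally_bounded:
  assumes "r \<ge> 0"
  obtains B where "\<forall>\<^sub>F m in sequentially. \<forall>z. cmod z \<le> r \<longrightarrow> cmod (poly (p m) z) \<le> B"
proof -
  define E where "E = (\<lambda>m. coeff (p m) 1 / coeff (p m) 0)"
  define S where "S = (\<lambda>m. (E m)\<^sup>2 - 2 * coeff (p m) 2 / coeff (p m) 0)"
  define U where "U = (\<lambda>m. (cmod (coeff (p m) 0))\<^sup>2 * exp (2 * (r * cmod (E m)) + r\<^sup>2 * cmod (S m)))"
  have "U \<longlonglongrightarrow> (cmod (a 0))\<^sup>2 *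
      exp (2 * (r * cmod (a 1 / a 0)) + r\<^sup>2 * cmod ((a 1 / a 0)\<^sup>2 - 2 * a 2 / a 0))"
    unfolding U_def S_def E_def by (intro tendsto_intros coeff_tendsto a0)
  then obtain L where L: "U \<longlonglongrightarrow> L" by blast
  have "\<forall>\<^sub>F m in sequentially. coeff (p m) 0 \<noteq> 0"
    using tendsto_imp_eventually_ne[OF coeff_tendsto a0] .
  moreover have "\<forall>\<^sub>F m in sequentially. U m < L + 1"
    by (rule order_tendstoD(2)[OF L]) simp
  ultimately have "\<forall>\<^sub>F m in sequentially. \<forall>z. cmod z \<le> r \<longrightarrow> cmod (poly (p m) z) \<le> sqrt (L + 1)"
  proof eventually_elim
    case (elim m)
    show ?case
    proof (intro allI impI)
      fix z assume z: "cmod z \<le> r"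
      have 1: "coeff (pderiv (p m)) 0 = coeff (p m) (Suc 0)" "coeff (pderiv (pderiv (p m))) 0 = 2 * coeff (p m) 2"
        by (simp_all add: coeff_pderiv numeral_2_eq_2)
      have "(cmod (poly (p m) z))\<^sup>2 \<le> (cmod (coeff (p m) 0))\<^sup>2 *
          exp (2 * Re (z * E m) + (cmod z)\<^sup>2 * Re (S m))"
        using real_rooted_norm_bound[OF real_rooted, of m 0 z] elim(1)
        by (simp add: 1 poly_0_coeff_0 E_def S_def)
      also have "\<dots> \<le> U m"
      proof -
        have "Re (z * E m) \<le> cmod z * cmod (E m)"
          using complex_Re_le_cmod[of "z * E m"] by (simp add: norm_mult)
        also have "\<dots> \<le> r * cmod (E m)" using z by (intro mult_right_mono) auto
        finally have "Re (z * E m) \<le> r * cmod (E m)" .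
        moreover have "(cmod z)\<^sup>2 * Re (S m) \<le> (cmod z)\<^sup>2 * cmod (S m)"
          by (intro mult_left_mono complex_Re_le_cmod) auto
        moreover have "\<dots> \<le> r\<^sup>2 * cmod (S m)"
          using z by (intro mult_right_mono power_mono) auto
        ultimately show ?thesis unfolding U_def by (intro mult_left_mono) auto
      qed
      finally show "cmod (poly (p m) z) \<le> sqrt (L + 1)"
        using elim(2) by (intro real_le_rsqrt) auto
    qed
  qed
  then show ?thesis by (rule that)
qed

text \<open>A uniform bound on a larger disc gives, by Cauchy's estimate, a geometric majorant for
  the coefficients, so the limit can be taken term by term.\<close>

lemma uniform_limit_cball: "uniform_limit (cball 0 R) (\<lambda>m. poly (p m)) f sequentially"
proof -
  define r where "r = \<bar>R\<bar> + 1"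
  have r: "r > 0" "R \<le> r" by (auto simp: r_def)
  \<comment> \<open>The radius is doubled so that Cauchy's estimate at 2r leaves a factor 2^(-j) for
    terms evaluated within radius r.\<close>
  obtain B where B: "\<forall>\<^sub>F m in sequentially. \<forall>z. cmod z \<le> 2 * r \<longrightarrow> cmod (poly (p m) z) \<le> B"
    by (rule locally_bounded[of "2 * r"]) (use r in auto)
  have coeff_le: "\<forall>\<^sub>F m in sequentially. \<forall>j. cmod (coeff (p m) j) \<le> B / (2 * r) ^ j"
    using B
  proof eventually_elim
    case (elim m)
    then show ?case using r by (intro allI coeff_norm_le_of_norm_le) auto
  qed
  have a_le: "cmod (a j) \<le> B / (2 * r) ^ j" for j
    by (rule tendsto_upperbound[OF tendsto_norm[OF coeff_tendsto]])
       (use coeff_le in \<open>auto elim: eventually_mono\<close>)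
  define d where "d = (\<lambda>j m. cmod (coeff (p m) j - a j) * r ^ j)"
  have d_le: "\<forall>\<^sub>F m in sequentially. \<forall>j. norm (d j m) \<le> 2 * B * (1 / 2) ^ j"
    using coeff_le
  proof eventually_elim
    case (elim m)
    show ?case
    proof
      fix j
      have "cmod (coeff (p m) j - a j) \<le> B / (2 * r) ^ j + B / (2 * r) ^ j"
        using elim a_le[of j] by (intro order_trans[OF norm_triangle_ineq4] add_mono) auto
      then have "d j m \<le> (B / (2 * r) ^ j + B / (2 * r) ^ j) * r ^ j"
        unfolding d_def using r by (intro mult_right_mono) auto
      also have "\<dots> = 2 * B * (1 / 2) ^ j"
        using r by (simp add: power_mult_distrib field_simps)
      finally show "norm (d j m) \<le> 2 * B * (1 / 2) ^ j"
        using r by (simp add: d_def)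
    qed
  qed
  \<comment> \<open>Dominated convergence for series: each term tends to 0 and the majorant is
    geometric, so the sum bounding the distance to \<open>f\<close> tends to 0.\<close>
  have tannery: "(\<forall>\<^sub>F m in sequentially. summable (\<lambda>j. norm (d j m))) \<and>
      summable (\<lambda>j::nat. norm (0::real)) \<and> (\<lambda>m. \<Sum>j. d j m) \<longlonglongrightarrow> (\<Sum>j::nat. 0)"
  proof (rule tannerys_theorem)
    show "d j \<longlonglongrightarrow> 0" for j
      unfolding d_def
      by (intro tendsto_mult_left_zero tendsto_norm_zero) (simp add: LIM_zero coeff_tendsto)
    show "\<forall>\<^sub>F (j, m) in sequentially \<times>\<^sub>F sequentially. norm (d j m) \<le> 2 * B * (1 / 2) ^ j"
      unfolding eventually_prod_filter using d_le
      by (intro exI[of _ "\<lambda>_. True"] exI conjI) auto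
    show "summable (\<lambda>j. 2 * B * (1 / 2) ^ j)"
      by (intro summable_mult summable_geometric) auto
  qed simp
  show ?thesis
  proof (rule uniform_limitI)
    fix e :: real assume "e > 0"
    have "(\<lambda>m. \<Sum>j. d j m) \<longlonglongrightarrow> 0" using tannery by simp
    from order_tendstoD(2)[OF this \<open>e > 0\<close>] have "\<forall>\<^sub>F m in sequentially. (\<Sum>j. d j m) < e" .
    with conjunct1[OF tannery]
    show "\<forall>\<^sub>F m in sequentially. \<forall>z\<in>cball 0 R. dist (poly (p m) z) (f z) < e"
    proof eventually_elim
      case (elim m)
      have summ: "summable (\<lambda>j. d j m)" using elim(1) by (rule summable_norm_cancel)
      show ?case
      proof
        fix z :: complex assume "z \<in> cball 0 R"
        then have z: "cmod z \<le> r" using r by auto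
        have le: "norm ((coeff (p m) j - a j) * z ^ j) \<le> d j m" for j
          unfolding d_def norm_mult norm_power
          using z by (intro mult_left_mono power_mono) auto
        have "(\<lambda>j. (coeff (p m) j - a j) * z ^ j) sums (poly (p m) z - f z)"
          using sums_diff[OF poly_sums[of "p m" z] f_sums[of z]] by (simp add: algebra_simps)
        then have "poly (p m) z - f z = (\<Sum>j. (coeff (p m) j - a j) * z ^ j)"
          by (simp add: sums_unique)
        then have "dist (poly (p m) z) (f z) \<le> (\<Sum>j. d j m)"
          unfolding dist_norm using norm_suminf_le[OF le summ] by simp
        with elim(2) show "dist (poly (p m) z) (f z) < e" by simp
      qed
    qed
  qed
qed

lemma higher_deriv_tendsto:
  "(\<lambda>m. poly ((pderiv ^^ k) (p m)) z) \<longlonglongrightarrow> (deriv ^^ k) f z"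
proof -
  have "uniform_limit (ball 0 (cmod z + 1)) (\<lambda>m. poly (p m)) f sequentially"
    using uniform_limit_cball[of "cmod z + 1"] by (rule uniform_limit_on_subset) auto
  then have "(\<lambda>m. (deriv ^^ k) (poly (p m)) z) \<longlonglongrightarrow> (deriv ^^ k) f z"
    by (rule higher_deriv_complex_uniform_limit) (auto intro!: always_eventually holomorphic_intros)
  then show ?thesis by (simp add: higher_deriv_poly)
qed

lemma real_rooted_higher_pderiv: "real_rooted ((pderiv ^^ k) (p m))"
  by (induction k) (auto simp: real_rooted real_rooted_pderiv)

section \<open>Location and multiplicity of the zeros of the limit\<close>

lemma norm_mono:
  assumes "\<bar>s\<bar> \<le> \<bar>y\<bar>"
  shows "cmod (f (Complex x s)) \<le> cmod (f (Complex x y))"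
proof (rule LIMSEQ_le)
  show "(\<lambda>m. cmod (poly (p m) (Complex x s))) \<longlonglongrightarrow> cmod (f (Complex x s))" for s
    using tendsto_norm[OF higher_deriv_tendsto[of 0]] by simp
  then show "(\<lambda>m. cmod (poly (p m) (Complex x y))) \<longlonglongrightarrow> cmod (f (Complex x y))" .
qed (use real_rooted_norm_mono[OF real_rooted assms] in blast)

text \<open>By \<open>norm_mono\<close>, a nonreal zero makes \<open>f\<close> vanish on the
  vertical segment joining it to its conjugate. The identity theorem then gives f = 0, contrary to
  \<open>a0\<close>.\<close>

lemma zero_imp_real:
  assumes "f z = 0"
  shows "z \<in> \<real>"
proof (rule ccontr)
  assume "z \<notin> \<real>"
  then have y: "Im z \<noteq> 0" by (simp add: complex_is_Real_iff)
  define U where "U = Complex (Re z) ` {-\<bar>Im z\<bar>..\<bar>Im z\<bar>}"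
  have "f 0 = 0"
  proof (rule analytic_continuation[of f UNIV U "Complex (Re z) 0"])
    show "Complex (Re z) 0 islimpt U"
    proof (rule connected_imp_perfect)
      show "connected U" unfolding U_def Complex_eq
        by (intro connected_continuous_image continuous_intros) auto
      show "Complex (Re z) 0 \<in> U" by (auto simp: U_def)
      show "U \<noteq> {w}" for w
      proof
        assume "U = {w}"
        moreover have "Complex (Re z) 0 \<in> U" "Complex (Re z) \<bar>Im z\<bar> \<in> U" by (auto simp: U_def)
        ultimately have "Complex (Re z) 0 = Complex (Re z) \<bar>Im z\<bar>" by (metis singletonD)
        with y show False by simp
      qed
    qed
    show "f w = 0" if "w \<in> U" for w
    proof -
      obtain s where s: "w = Complex (Re z) s" "\<bar>s\<bar> \<le> \<bar>Im z\<bar>"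
        using \<open>w \<in> U\<close> by (auto simp: U_def)
      have "cmod (f w) \<le> 0" using norm_mono[OF s(2), of "Re z"] assms by (simp add: s)
      then show ?thesis by simp
    qed
  qed (auto simp: holomorphic)
  moreover have "f 0 = a 0" using f_sums[of 0] sums_unique2 powser_sums_zero by blast
  ultimately show False using a0 by simp
qed

text \<open>If the value were nonzero, the exponent in \<open>real_rooted_norm_bound\<close> would tend to $0$ and
  Liouville's theorem would make the derivative constant.\<close>

lemma two_derivs_zero_imp_zero:
  fixes x :: real
  assumes "(deriv ^^ Suc k) f x = 0" "(deriv ^^ Suc (Suc k)) f x = 0"
    and nonconst: "\<not> (deriv ^^ k) f constant_on UNIV"
  shows "(deriv ^^ k) f x = 0"
proof (rule ccontr)
  assume nz: "(deriv ^^ k) f x \<noteq> 0"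
  let ?q = "\<lambda>m. (pderiv ^^ k) (p m)" and ?g = "(deriv ^^ k) f"
  have bound: "(cmod (?g (x + w)))\<^sup>2 \<le> (cmod (?g x))\<^sup>2" for w :: complex
  proof -
    let ?E = "\<lambda>m. poly (pderiv (?q m)) x / poly (?q m) x"
    let ?S = "\<lambda>m. (?E m)\<^sup>2 - poly (pderiv (pderiv (?q m))) x / poly (?q m) x"
    \<comment> \<open>The two hypotheses enter here: the first and second derivatives of the
      approximants tend to 0 at \<open>x\<close>, and hence so does the whole exponent of the
      bound.\<close>
    have t: "(\<lambda>m. poly (?q m) z) \<longlonglongrightarrow> ?g z"
      "(\<lambda>m. poly (pderiv (?q m)) x) \<longlonglongrightarrow> 0"
      "(\<lambda>m. poly (pderiv (pderiv (?q m))) x) \<longlonglongrightarrow> 0" for z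
      using higher_deriv_tendsto[of k z] higher_deriv_tendsto[of "Suc k" x]
        higher_deriv_tendsto[of "Suc (Suc k)" x] assms(1,2) by simp_all
    have "(\<lambda>m. (cmod (poly (?q m) x))\<^sup>2 * exp (2 * Re (w * ?E m) + (cmod w)\<^sup>2 * Re (?S m)))
        \<longlonglongrightarrow> (cmod (?g x))\<^sup>2 * exp (2 * Re (w * (0 / ?g x)) + (cmod w)\<^sup>2 * Re ((0 / ?g x)\<^sup>2 - 0 / ?g x))"
      by (intro tendsto_intros t nz)
    moreover have "(\<lambda>m. (cmod (poly (?q m) (x + w)))\<^sup>2) \<longlonglongrightarrow> (cmod (?g (x + w)))\<^sup>2"
      by (intro tendsto_intros t)
    moreover have "\<forall>\<^sub>F m in sequentially. (cmod (poly (?q m) (x + w)))\<^sup>2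
        \<le> (cmod (poly (?q m) x))\<^sup>2 * exp (2 * Re (w * ?E m) + (cmod w)\<^sup>2 * Re (?S m))"
      using tendsto_imp_eventually_ne[OF t(1) nz]
      by eventually_elim (rule real_rooted_norm_bound[OF real_rooted_higher_pderiv])
    ultimately have "(cmod (?g (x + w)))\<^sup>2
        \<le> (cmod (?g x))\<^sup>2 * exp (2 * Re (w * (0 / ?g x)) + (cmod w)\<^sup>2 * Re ((0 / ?g x)\<^sup>2 - 0 / ?g x))"
      by (intro tendsto_le[OF sequentially_bot])
    then show ?thesis by simp
  qed
  have "cmod (?g z) \<le> cmod (?g x)" for z
  proof (rule power2_le_imp_le)
    show "(cmod (?g z))\<^sup>2 \<le> (cmod (?g x))\<^sup>2" using bound[of "z - x"] by simp
  qed simp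
  then have "bounded (range ?g)" by (auto simp: bounded_iff)
  then have "?g constant_on UNIV"
    by (intro Liouville_theorem holomorphic_higher_deriv holomorphic) auto
  with nonconst show False ..
qed

text \<open>The descent from a double zero, for any equation f^(d+1) = c z f; it is applied with d =
  2n - 2.\<close>

lemma simple_zeros:
  assumes ode: "\<And>z. (deriv ^^ Suc d) f z = c * (z * f z)" and "c \<noteq> 0" and "f z = 0"
  shows "deriv f z \<noteq> 0"
proof
  assume "deriv f z = 0"
  obtain x where z: "z = of_real x"
    using zero_imp_real[OF \<open>f z = 0\<close>] by (elim Reals_cases)
  have f0: "f 0 \<noteq> 0"
    using f_sums[of 0] a0 sums_unique2 powser_sums_zero by metis
  have deriv_f: "((deriv ^^ j) f has_field_derivative (deriv ^^ Suc j) f w) (at w)" for j w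
    using holomorphic_derivI[of "(deriv ^^ j) f" UNIV w] holomorphic_higher_deriv[OF holomorphic] by simp
  \<comment> \<open>Leibniz' rule for the j-th derivative of z f. At j = 0 the truncated index
    \<open>j - 1\<close> is harmless, because its term carries the factor j.\<close>
  have ode_deriv: "(deriv ^^ (Suc d + j)) f w =
      c * (w * (deriv ^^ j) f w + of_nat j * (deriv ^^ (j - 1)) f w)" for j w
  proof (induction j arbitrary: w)
    case (Suc j)
    have "((\<lambda>w. c * (w * (deriv ^^ j) f w + of_nat j * (deriv ^^ (j - 1)) f w)) has_field_derivative
        c * ((deriv ^^ j) f w + w * (deriv ^^ Suc j) f w + of_nat j * (deriv ^^ j) f w)) (at w)"
      using deriv_f[of "j - 1" w] deriv_f[of j w]
      by (cases j) (auto intro!: derivative_eq_intros)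
    moreover have "(deriv ^^ (Suc d + j)) f = (\<lambda>w. c * (w * (deriv ^^ j) f w + of_nat j * (deriv ^^ (j - 1)) f w))"
      by (intro ext Suc.IH)
    ultimately have "deriv ((deriv ^^ (Suc d + j)) f) w =
        c * ((deriv ^^ j) f w + w * (deriv ^^ Suc j) f w + of_nat j * (deriv ^^ j) f w)"
      by (simp only: DERIV_imp_deriv)
    then show ?case by (simp add: algebra_simps)
  qed (simp add: ode[simplified])
  \<comment> \<open>If f^(k) were constant for some k <= d, then f^(d+2) would be 0, but the
    differentiated equation gives f^(d+2)(0) = c f(0), which is nonzero.\<close>
  have nonconst: "\<not> (deriv ^^ k) f constant_on UNIV" if "k \<le> d" for k
  proof
    assume "(deriv ^^ k) f constant_on UNIV"
    then obtain b where "(deriv ^^ k) f = (\<lambda>_. b)" by (auto simp: constant_on_def)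
    then have "(deriv ^^ Suc i) ((deriv ^^ k) f) = (\<lambda>_. 0)" for i
      by (induction i) auto
    from this[of "Suc d - k"] have "(deriv ^^ (Suc d + 1)) f 0 = 0"
      using that by (simp add: Suc_diff_le flip: funpow_add o_apply[of "deriv ^^ _" "deriv ^^ _"])
    then show False using ode_deriv[of 1 0] f0 \<open>c \<noteq> 0\<close> by simp
  qed
  \<comment> \<open>Downward induction on consecutive pairs of orders. The starting pair d+1, d+2
    vanishes by the equation and its first derivative, since f(z) = f'(z) = 0.\<close>
  have top: "(deriv ^^ (Suc d - i)) f z = 0 \<and> (deriv ^^ Suc (Suc d - i)) f z = 0" if "i \<le> Suc d" for i
    using that
  proof (induction i)
    case 0
    show ?case
      using ode_deriv[of 0 z] ode_deriv[of 1 z] \<open>f z = 0\<close> \<open>deriv f z = 0\<close> by simp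
  next
    case (Suc i)
    define k where "k = Suc d - Suc i"
    have k: "Suc d - i = Suc k" "k \<le> d" using Suc.prems by (auto simp: k_def)
    have IH: "(deriv ^^ Suc k) f z = 0" "(deriv ^^ Suc (Suc k)) f z = 0"
      using Suc.IH Suc.prems unfolding k by auto
    have "(deriv ^^ k) f z = 0"
      using two_derivs_zero_imp_zero[of k x] IH nonconst[OF k(2)] unfolding z by blast
    with IH(1) show ?case unfolding k_def [symmetric] by blast
  qed
  \<comment> \<open>Orders up to d+1 come from \<open>top\<close>; every higher order reduces by
    \<open>ode_deriv\<close> to strictly smaller ones.\<close>
  have "(deriv ^^ k) f z = 0" for k
  proof (induction k rule: less_induct)
    case (less k)
    show ?case
    proof (cases "k \<le> Suc d")
      case True
      then show ?thesis using top[of "Suc d - k"] by simp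
    next
      case False
      define j where "j = k - Suc d"
      have k: "k = Suc d + j" "j < k" "j - 1 < k" using False by (auto simp: j_def)
      then show ?thesis using ode_deriv[of j z] less.IH by simp
    qed
  qed
  then have "f 0 = 0"
    by (rule holomorphic_fun_eq_0_on_connected[OF holomorphic open_UNIV connected_UNIV]) auto
  with f0 show False ..
qed

end

subsection \<open>Moments, power series and differential equation\<close>

definition polya_moment :: "nat \<Rightarrow> nat \<Rightarrow> real" where
  "polya_moment n k = (LINT t|lborel. t ^ k * exp (- (t ^ (2 * n))))"

lemma square_minus_one_le_even_power:
  fixes t :: real
  assumes "n \<ge> 1"
  shows "t\<^sup>2 - 1 \<le> t ^ (2 * n)"
proof (cases "1 \<le> t\<^sup>2")
  case True
  then have "(t\<^sup>2) ^ 1 \<le> (t\<^sup>2) ^ n" by (rule power_increasing[OF assms])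
  then show ?thesis by (simp add: power_mult)
next
  case False
  then have "t\<^sup>2 - 1 \<le> 0" by simp
  also have "0 \<le> (t\<^sup>2) ^ n" by simp
  finally show ?thesis by (simp add: power_mult)
qed

text \<open>Comparison with a Gaussian, using t^(2n) >= t^2 - 1 and r|t| <= t^2/2 + r^2/2. This
  function is the majorant for integrating the power series termwise.\<close>

lemma integrable_exp_even_power:
  fixes r :: real
  assumes "n \<ge> 1"
  shows "integrable lborel (\<lambda>t. exp (- (t ^ (2 * n)) + r * \<bar>t\<bar>))"
proof (rule Bochner_Integration.integrable_bound)
  have "integrable lborel (\<lambda>t. exp (1 + r\<^sup>2 / 2) * sqrt (2 * pi) * std_normal_density t)"
    using integrable_std_normal_moment[of 0] by simp
  then show "integrable lborel (\<lambda>t. exp (1 + r\<^sup>2 / 2) * exp (- t\<^sup>2 / 2))"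
    by (simp add: std_normal_density_def)
  show "AE t in lborel. norm (exp (- (t ^ (2 * n)) + r * \<bar>t\<bar>)) \<le> norm (exp (1 + r\<^sup>2 / 2) * exp (- t\<^sup>2 / 2))"
  proof (rule AE_I2)
    fix t :: real
    have "0 \<le> (\<bar>t\<bar> - r)\<^sup>2" by simp
    then have "r * \<bar>t\<bar> \<le> t\<^sup>2 / 2 + r\<^sup>2 / 2" by (simp add: power2_eq_square algebra_simps)
    with square_minus_one_le_even_power[OF assms, of t]
    have "- (t ^ (2 * n)) + r * \<bar>t\<bar> \<le> (1 + r\<^sup>2 / 2) + (- t\<^sup>2 / 2)" by linarith
    then show "norm (exp (- (t ^ (2 * n)) + r * \<bar>t\<bar>)) \<le> norm (exp (1 + r\<^sup>2 / 2) * exp (- t\<^sup>2 / 2))"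
      by (simp flip: exp_add)
  qed
qed simp

lemma power_le_fact_exp:
  fixes x :: real
  assumes "x \<ge> 0"
  shows "x ^ k \<le> fact k * exp x"
proof -
  have "(\<Sum>j\<in>{k}. x ^ j /\<^sub>R fact j) \<le> (\<Sum>j. x ^ j /\<^sub>R fact j)"
    using assms by (intro sum_le_suminf summable_exp_generic) auto
  then have "x ^ k / fact k \<le> exp x" by (simp add: exp_def field_simps)
  then show ?thesis by (simp add: field_simps)
qed

lemma integrable_polya_moment:
  assumes "n \<ge> 1"
  shows "integrable lborel (\<lambda>t::real. t ^ k * exp (- (t ^ (2 * n))))"
proof (rule Bochner_Integration.integrable_bound)
  show "integrable lborel (\<lambda>t::real. fact k * exp (- (t ^ (2 * n)) + 1 * \<bar>t\<bar>))"
    by (intro integrable_mult_right integrable_exp_even_power assms)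
  show "AE t::real in lborel. norm (t ^ k * exp (- (t ^ (2 * n)))) \<le> norm (fact k * exp (- (t ^ (2 * n)) + 1 * \<bar>t\<bar>))"
  proof (rule AE_I2)
    fix t :: real
    have "\<bar>t\<bar> ^ k * exp (- (t ^ (2 * n))) \<le> fact k * exp \<bar>t\<bar> * exp (- (t ^ (2 * n)))"
      by (intro mult_right_mono power_le_fact_exp) auto
    then show "norm (t ^ k * exp (- (t ^ (2 * n)))) \<le> norm (fact k * exp (- (t ^ (2 * n)) + 1 * \<bar>t\<bar>))"
      by (simp add: abs_mult power_abs exp_diff exp_minus field_simps)
  qed
qed simp

lemma polya_moment_odd:
  assumes "odd k"
  shows "polya_moment n k = 0"
proof -
  let ?h = "\<lambda>t::real. t ^ k * exp (- (t ^ (2 * n)))"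
  have "polya_moment n k = (LINT t|lborel. ?h (0 + (-1) * t))"
    unfolding polya_moment_def by (subst lborel_integral_real_affine[of "-1" _ 0]) auto
  also have "(\<lambda>t. ?h (0 + (-1) * t)) = (\<lambda>t. - ?h t)"
    using assms by (simp add: power_mult fun_eq_iff)
  finally show ?thesis by (simp add: polya_moment_def)
qed

text \<open>The substitution u = t^(2n) on the positive half-line turns the integral into Euler's
  integral for Gamma; evenness of the integrand doubles the result.\<close>

lemma polya_moment_even:
  assumes "n \<ge> 1"
  shows "polya_moment n (2 * k) = Gamma (real (2 * k + 1) / real (2 * n)) / real n"
proof -
  let ?h = "\<lambda>t::real. t ^ (2 * k) * exp (- (t ^ (2 * n)))"
  define s where "s = real (2 * k + 1) / real (2 * n)"
  have s: "s > 0" using assms by (simp add: s_def)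
  let ?f = "\<lambda>u::real. u powr (s - 1) / exp u"
  let ?g = "\<lambda>t::real. t ^ (2 * n)" and ?g' = "\<lambda>t::real. real (2 * n) * t ^ (2 * n - 1)"
  have inj: "inj_on ?g {0<..}"
    by (rule inj_onI) (use assms in \<open>auto intro: power_eq_imp_eq_base\<close>)
  have img: "?g ` {0<..} = {0<..}"
  proof (intro equalityI subsetI)
    fix y :: real assume "y \<in> {0<..}"
    then have "y = ?g (root (2 * n) y)" "root (2 * n) y > 0" using assms by auto
    then show "y \<in> ?g ` {0<..}" by blast
  qed auto
  have int_f: "(?f has_integral Gamma s) {0<..}"
    using Gamma_integral_real[OF s] by (rule has_integral_spike_set_eq[THEN iffD1, rotated 2])
      (auto intro: negligible_subset[of "{0}"])
  have "?f absolutely_integrable_on {0<..}"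
    using int_f by (intro nonnegative_absolutely_integrable_1) (auto simp: integrable_on_def)
  with int_f have "?f absolutely_integrable_on ?g ` {0<..} \<and> integral (?g ` {0<..}) ?f = Gamma s"
    unfolding img by (auto simp: integral_unique)
  then have sub: "(\<lambda>t. \<bar>?g' t\<bar> * ?f (?g t)) absolutely_integrable_on {0<..} \<and>
      integral {0<..} (\<lambda>t. \<bar>?g' t\<bar> * ?f (?g t)) = Gamma s"
    by (subst has_absolute_integral_change_of_variables_1'[OF _ _ inj])
       (auto intro!: derivative_eq_intros)
  have eq: "\<bar>?g' t\<bar> * ?f (?g t) = real (2 * n) * ?h t" if "t \<in> {0<..}" for t
  proof -
    have t: "t > 0" using that by simp
    have "?g t powr (s - 1) = t powr (real (2 * n) * (s - 1))"
      using t by (simp add: powr_powr flip: powr_realpow)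
    moreover have "?g' t = real (2 * n) * t powr (real (2 * n) - 1)"
      using t assms by (simp add: of_nat_diff flip: powr_realpow)
    moreover have "t powr (real (2 * n) - 1) * t powr (real (2 * n) * (s - 1)) = t ^ (2 * k)"
    proof -
      have "real (2 * n) - 1 + real (2 * n) * (s - 1) = real (2 * k)"
        using assms by (simp add: s_def field_simps)
      then show ?thesis using t by (simp only: flip: powr_add powr_realpow)
    qed
    ultimately show ?thesis using t assms
      by (simp add: exp_minus field_simps)
  qed
  have "integral {0<..} (\<lambda>t. \<bar>?g' t\<bar> * ?f (?g t)) = integral {0<..} (\<lambda>t. real (2 * n) * ?h t)"
    by (rule integral_cong) (rule eq)
  also have "\<dots> = real (2 * n) * integral {0<..} ?h" by simp
  finally have "real (2 * n) * integral {0<..} ?h = Gamma s"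
    using sub by (simp only:)
  moreover have "integral {0<..} ?h = integral {0..} ?h"
    by (rule integral_subset_negligible) (auto intro: negligible_subset[of "{0}"])
  ultimately have val: "integral {0..} ?h = Gamma s / real (2 * n)"
    using assms by (simp add: field_simps)
  have "set_integrable lborel {0..} ?h"
    unfolding set_integrable_def using integrable_polya_moment[OF assms]
    by (intro integrable_mult_indicator) auto
  then have "has_bochner_integral lborel (\<lambda>x. indicator {0..} x *\<^sub>R ?h x) (Gamma s / real (2 * n))"
    using set_borel_integral_eq_integral(2)[of "{0..}" ?h] val
    by (simp add: has_bochner_integral_iff set_integrable_def set_lebesgue_integral_def)
  then have "has_bochner_integral lborel ?h (2 *\<^sub>R (Gamma s / real (2 * n)))"
    by (rule has_bochner_integral_even_function) (simp add: power_mult)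
  then show ?thesis using assms
    by (simp add: polya_moment_def has_bochner_integral_iff s_def)
qed

lemma polya_moment_0_pos: "n \<ge> 1 \<Longrightarrow> polya_moment n 0 > 0"
  using polya_moment_even[of n 0] by (simp add: Gamma_real_pos)

text \<open>This is the integration by parts in moment form. For even \<open>k\<close> it is Gamma(s
  + 1) = s Gamma(s) with s = (k+1)/(2n); for odd \<open>k\<close> both sides vanish.\<close>

lemma polya_moment_rec:
  assumes "n \<ge> 1"
  shows "polya_moment n (k + 2 * n) = real (Suc k) / real (2 * n) * polya_moment n k"
proof (cases "even k")
  case True
  then obtain j where j: "k = 2 * j" by (elim evenE)
  define s where "s = real (2 * j + 1) / real (2 * n)"
  have "s > 0" using assms by (simp add: s_def)
  then have "s \<notin> \<int>\<^sub>\<le>\<^sub>0" by (auto elim!: nonpos_Ints_cases')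
  then have Gamma_s: "Gamma (s + 1) = s * Gamma s" by (rule Gamma_plus1)
  have "real (2 * (j + n) + 1) / real (2 * n) = s + 1"
    using assms by (simp add: s_def field_simps)
  then have "polya_moment n (2 * (j + n)) = s * (Gamma s / real n)"
    unfolding polya_moment_even[OF assms] using Gamma_s by simp
  also have "\<dots> = real (Suc k) / real (2 * n) * polya_moment n k"
    unfolding j polya_moment_even[OF assms] s_def by simp
  finally show ?thesis by (simp add: j algebra_simps)
next
  case False
  then show ?thesis by (simp add: polya_moment_odd)
qed

definition polya_coeff :: "nat \<Rightarrow> nat \<Rightarrow> complex" where
  "polya_coeff n k = \<i> ^ k / fact k * polya_moment n k"

text \<open>Expand exp(izt) and integrate termwise; the partial sums are dominated by exp(-t^(2n) +
  |z||t|).\<close>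

lemma polya_F_sums:
  assumes "n \<ge> 1"
  shows "(\<lambda>k. polya_coeff n k * z ^ k) sums polya_F (2 * n) z"
proof -
  define g where "g = (\<lambda>k t. (\<i> * z) ^ k / fact k * of_real (t ^ k * exp (- (t ^ (2 * n)))))"
  define w where "w = (\<lambda>t::real. exp (- (t ^ (2 * n)) + cmod z * \<bar>t\<bar>))"
  have int_g: "integrable lborel (g k)" for k
    unfolding g_def
    by (intro integrable_mult_right integrable_of_real integrable_polya_moment assms)
  have LINT_g: "(LINT t|lborel. g k t) = polya_coeff n k * z ^ k" for k
    unfolding g_def polya_coeff_def polya_moment_def
    by (simp add: power_mult_distrib del: of_real_mult)
  have g_eq: "g k t = exp (- (of_real t ^ (2 * n))) * ((\<i> * z * of_real t) ^ k / fact k)" for k t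
    by (simp add: g_def power_mult_distrib exp_of_real flip: of_real_power of_real_minus)
  have norm_g: "norm (g k t) = exp (- (t ^ (2 * n))) * ((cmod z * \<bar>t\<bar>) ^ k /\<^sub>R fact k)" for k t
    by (simp add: g_def norm_mult norm_divide norm_power power_mult_distrib power_abs abs_mult field_simps)
  have "(\<lambda>N. LINT t|lborel. (\<Sum>k<N. g k t)) \<longlonglongrightarrow> (LINT t|lborel. exp (- (complex_of_real t ^ (2 * n))) * exp (\<i> * z * of_real t))"
  proof (rule integral_dominated_convergence)
    show "integrable lborel w" unfolding w_def by (rule integrable_exp_even_power[OF assms])
    show "AE t in lborel. (\<lambda>N. \<Sum>k<N. g k t) \<longlonglongrightarrow> exp (- (complex_of_real t ^ (2 * n))) * exp (\<i> * z * of_real t)"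
    proof (rule AE_I2)
      fix t :: real
      have "(\<lambda>k. (\<i> * z * of_real t) ^ k / fact k) sums exp (\<i> * z * of_real t)"
        using exp_converges[of "\<i> * z * of_real t"] by (simp add: scaleR_conv_of_real field_simps)
      from sums_mult[OF this, of "exp (- (complex_of_real t ^ (2 * n)))"]
      show "(\<lambda>N. \<Sum>k<N. g k t) \<longlonglongrightarrow> exp (- (complex_of_real t ^ (2 * n))) * exp (\<i> * z * of_real t)"
        by (simp add: sums_def g_eq)
    qed
    show "AE t in lborel. norm (\<Sum>k<N. g k t) \<le> w t" for N
    proof (rule AE_I2)
      fix t :: real
      have "norm (\<Sum>k<N. g k t) \<le> (\<Sum>k<N. exp (- (t ^ (2 * n))) * ((cmod z * \<bar>t\<bar>) ^ k /\<^sub>R fact k))"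
        by (intro order_trans[OF norm_sum] sum_mono) (simp only: norm_g order_refl)
      also have "\<dots> = exp (- (t ^ (2 * n))) * (\<Sum>k<N. (cmod z * \<bar>t\<bar>) ^ k /\<^sub>R fact k)"
        by (simp only: sum_distrib_left)
      finally have le: "norm (\<Sum>k<N. g k t) \<le> exp (- (t ^ (2 * n))) * (\<Sum>k<N. (cmod z * \<bar>t\<bar>) ^ k /\<^sub>R fact k)" .
      have exp_series: "exp (cmod z * \<bar>t\<bar>) = (\<Sum>k. (cmod z * \<bar>t\<bar>) ^ k /\<^sub>R fact k)"
        by (simp add: exp_def)
      then have "exp (- (t ^ (2 * n))) * (\<Sum>k<N. (cmod z * \<bar>t\<bar>) ^ k /\<^sub>R fact k) \<le> exp (- (t ^ (2 * n))) * exp (cmod z * \<bar>t\<bar>)"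
        unfolding exp_series
        by (intro mult_left_mono sum_le_suminf summable_exp_generic) auto
      with le show "norm (\<Sum>k<N. g k t) \<le> w t" unfolding w_def exp_add by linarith
    qed
    show "(\<lambda>t. \<Sum>k<N. g k t) \<in> borel_measurable lborel" for N
      using int_g by (intro borel_measurable_sum) (rule borel_measurable_integrable)
  qed simp
  then show ?thesis
    using int_g by (simp add: sums_def polya_F_def LINT_g)
qed

section \<open>The differential equation, by comparing power series coefficients\<close>

lemma fact_nth_higher_fps_deriv:
  "fact j * fps_nth ((fps_deriv ^^ k) g) j = fact (j + k) * fps_nth g (j + k)"
  for g :: "'a::field_char_0 fps"
proof (induction k arbitrary: j)
  case (Suc k)
  have "fact j * fps_nth ((fps_deriv ^^ Suc k) g) j = fact (Suc j) * fps_nth ((fps_deriv ^^ k) g) (Suc j)"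
    by (simp add: algebra_simps)
  then show ?case by (simp only: Suc.IH add_Suc_shift)
qed simp

lemma higher_deriv_eval_fps:
  fixes g :: "complex fps"
  assumes "fps_conv_radius g = \<infinity>"
  shows "(deriv ^^ k) (eval_fps g) = eval_fps ((fps_deriv ^^ k) g)"
    and "fps_conv_radius ((fps_deriv ^^ k) g) = \<infinity>"
proof -
  have "(deriv ^^ k) (eval_fps g) = eval_fps ((fps_deriv ^^ k) g) \<and> fps_conv_radius ((fps_deriv ^^ k) g) = \<infinity>"
  proof (induction k)
    case (Suc k)
    have "fps_conv_radius ((fps_deriv ^^ k) g) \<le> fps_conv_radius ((fps_deriv ^^ Suc k) g)"
      using fps_conv_radius_deriv by simp
    moreover have "deriv (eval_fps ((fps_deriv ^^ k) g)) = eval_fps ((fps_deriv ^^ Suc k) g)"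
      by (intro ext DERIV_imp_deriv) (simp add: Suc.IH has_field_derivative_eval_fps)
    ultimately show ?case using Suc.IH by simp
  qed (use assms in simp)
  then show "(deriv ^^ k) (eval_fps g) = eval_fps ((fps_deriv ^^ k) g)"
    and "fps_conv_radius ((fps_deriv ^^ k) g) = \<infinity>" by auto
qed

text \<open>Coefficient by coefficient, the equation is the moment recurrence
  \<open>polya_moment_rec\<close>.\<close>

lemma polya_F_ode:
  assumes "n \<ge> 1"
  shows "(deriv ^^ (2 * n - 1)) (polya_F (2 * n)) z = (-1) ^ n / of_nat (2 * n) * (z * polya_F (2 * n) z)"
proof -
  define g where "g = Abs_fps (polya_coeff n)"
  define c :: complex where "c = (-1) ^ n / of_nat (2 * n)"
  have "fps_conv_radius g = \<infinity>"
    unfolding fps_conv_radius_def g_def fps_nth_Abs_fps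
    by (rule conv_radius_inftyI'') (rule sums_summable[OF polya_F_sums[OF assms]])
  note g = this higher_deriv_eval_fps[OF this]
  have F: "polya_F (2 * n) = eval_fps g"
    using sums_unique[OF polya_F_sums[OF assms]] by (simp add: fun_eq_iff eval_fps_def g_def)
  have "(fps_deriv ^^ (2 * n - 1)) g = fps_const c * (fps_X * g)"
  proof (rule fps_ext)
    fix j
    have "fact j * fps_nth ((fps_deriv ^^ (2 * n - 1)) g) j = \<i> ^ (j + (2 * n - 1)) * polya_moment n (j + (2 * n - 1))"
      unfolding fact_nth_higher_fps_deriv by (simp add: g_def polya_coeff_def)
    also have "\<dots> = fact j * fps_nth (fps_const c * (fps_X * g)) j"
    proof (cases j)
      \<comment> \<open>The right side has no constant term, and the left one involves the moment of
        odd order 2n - 1.\<close>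
      case 0
      then show ?thesis using assms by (simp add: polya_moment_odd)
    next
      case (Suc i)
      have "j + (2 * n - 1) = i + 2 * n" using assms Suc by simp
      then have "\<i> ^ (j + (2 * n - 1)) * polya_moment n (j + (2 * n - 1)) =
          \<i> ^ i * (-1) ^ n * (of_nat (Suc i) / of_nat (2 * n) * polya_moment n i)"
        by (simp add: power_add power_mult polya_moment_rec[OF assms])
      then show ?thesis
        by (simp add: Suc g_def c_def polya_coeff_def)
    qed
    finally show "fps_nth ((fps_deriv ^^ (2 * n - 1)) g) j = fps_nth (fps_const c * (fps_X * g)) j" by simp
  qed
  then have "(deriv ^^ (2 * n - 1)) (polya_F (2 * n)) z = eval_fps (fps_const c * (fps_X * g)) z"
    by (simp only: F g)
  also have "\<dots> = c * (z * polya_F (2 * n) z)"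
  proof -
    have "fps_conv_radius (fps_X * g) = \<infinity>"
      using fps_conv_radius_mult[of fps_X g] g(1) by simp
    then show ?thesis using g(1) by (simp add: eval_fps_mult F)
  qed
  finally show ?thesis by (simp add: c_def)
qed

subsection \<open>Real-rooted approximations\<close>

lemma real_rooted_even_power:
  assumes "\<sigma> \<ge> 0"
  shows "real_rooted ([:1, 0, - complex_of_real \<sigma>:] ^ N)"
proof -
  have "z \<in> \<real>" if "poly ([:1, 0, - complex_of_real \<sigma>:] ^ N) z = 0" for z
  proof -
    have "\<sigma> * (z * z) = 1" using that by (simp add: algebra_simps)
    then have re: "\<sigma> * ((Re z)\<^sup>2 - (Im z)\<^sup>2) = 1" and im: "\<sigma> * (2 * Re z * Im z) = 0"
      by (auto simp: complex_eq_iff power2_eq_square)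
    have "Im z = 0"
    proof (rule ccontr)
      assume "Im z \<noteq> 0"
      with im re have "Re z = 0" by auto
      with re have "\<sigma> * (Im z)\<^sup>2 = -1" by simp
      moreover have "\<sigma> * (Im z)\<^sup>2 \<ge> 0" using assms by simp
      ultimately show False by linarith
    qed
    then show ?thesis by (simp add: complex_is_Real_iff)
  qed
  then show ?thesis by (simp add: real_rooted_def)
qed

lemma coeff_even_power:
  fixes c :: "'a::comm_ring_1"
  shows "coeff ([:1, 0, c:] ^ N) j = (if even j then of_nat (N choose (j div 2)) * c ^ (j div 2) else 0)"
proof -
  have "[:1, 0, c:] = monom c 2 + 1"
    by (simp add: monom_altdef numeral_2_eq_2 one_pCons)
  then have "[:1, 0, c:] ^ N = (\<Sum>k\<le>N. monom (of_nat (N choose k) * c ^ k) (2 * k))"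
    by (simp add: binomial_ring monom_power of_nat_poly smult_monom mult_ac)
  then have "coeff ([:1, 0, c:] ^ N) j = (\<Sum>k\<le>N. if 2 * k = j then of_nat (N choose k) * c ^ k else 0)"
    by (simp add: coeff_sum)
  also have "\<dots> = (if even j then of_nat (N choose (j div 2)) * c ^ (j div 2) else 0)"
  proof (cases "even j")
    case True
    then obtain i where j: "j = 2 * i" by (elim evenE)
    show ?thesis by (auto simp: j sum.delta binomial_eq_0)
  next
    case False
    then show ?thesis by (auto intro!: sum.neutral)
  qed
  finally show ?thesis .
qed

text \<open>One \<open>theta_shift\<close> is applied for each index in \<open>I\<close>.\<close>

lemma real_rooted_multiplier:
  assumes "finite I" "\<And>i. i \<in> I \<Longrightarrow> a i > 0" "real_rooted q"
  shows "\<exists>p. real_rooted p \<and> (\<forall>j. coeff p j = of_real (\<Prod>i\<in>I. real j + a i) * coeff q j)"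
  using assms(1,2)
proof (induction I rule: finite_induct)
  case empty
  then show ?case using assms(3) by auto
next
  case (insert i I)
  then obtain p where "real_rooted p" "\<And>j. coeff p j = of_real (\<Prod>i\<in>I. real j + a i) * coeff q j" by auto
  then show ?case using insert
    by (intro exI[of _ "theta_shift (a i) p"]) (simp add: real_rooted_theta_shift coeff_theta_shift)
qed

lemma real_rooted_smult: "real_rooted p \<Longrightarrow> real_rooted (smult c p)"
  by (auto simp: real_rooted_def)

section \<open>Limits of the approximating coefficients\<close>

lemma binomial_div_power_tendsto: "(\<lambda>N. real (N choose k) / real N ^ k) \<longlonglongrightarrow> 1 / fact k"
proof -
  have "real (N choose k) / real N ^ k = (\<Prod>i<k. (real N - real i) / real N) / fact k" for N
    by (simp add: binomial_gbinomial gbinomial_prod_rev prod_dividef atLeast0LessThan)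
  moreover have "(\<lambda>N. (\<Prod>i<k. (real N - real i) / real N) / fact k) \<longlonglongrightarrow> (\<Prod>i<k. 1) / fact k"
    by (intro tendsto_divide tendsto_prod tendsto_const) (real_asymp, simp)
  ultimately show ?thesis by simp
qed

text \<open>Gauss' multiplication formula up to the constant $Q(0)$, whose value is irrelevant here.\<close>

lemma prod_rGamma_arith_progression:
  fixes n k :: nat
  assumes "n \<ge> 1"
  defines "Q \<equiv> \<lambda>k. \<Prod>r<n. rGamma (real (2 * k + 1) / real (2 * n) + real r / real n)"
  shows "Q k * fact (2 * k) = Q 0 * (4 * real n) ^ k * fact k"
proof (induction k)
  case (Suc k)
  define s where "s = real (2 * k + 1) / real (2 * n)"
  have s: "s > 0" using assms(1) by (simp add: s_def)
  let ?h = "\<lambda>r. rGamma (s + real r / real n)"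
  have "rGamma (s + 1) \<noteq> 0" using s by (auto simp: rGamma_eq_zero_iff elim!: nonpos_Ints_cases')
  have "real (2 * Suc k + 1) / real (2 * n) + real r / real n = s + real (Suc r) / real n" for r
    using assms(1) by (simp add: s_def field_simps)
  then have "Q (Suc k) = (\<Prod>r<n. ?h (Suc r))" by (simp only: Q_def)
  \<comment> \<open>Raising \<open>k\<close> by one raises \<open>s\<close> by 1/n, so the two
    products share all factors except those at \<open>s\<close> and s + 1.\<close>
  then have "rGamma s * Q (Suc k) = (\<Prod>r<Suc n. ?h r)"
    by (subst prod.lessThan_Suc_shift) simp
  also have "\<dots> = Q k * rGamma (s + 1)"
    using assms(1) by (simp add: Q_def s_def)
  finally have "Q (Suc k) * s = Q k"
    using \<open>rGamma (s + 1) \<noteq> 0\<close> by (simp add: mult.commute flip: rGamma_plus1[of s])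
  then have "Q (Suc k) * real (2 * k + 1) = Q k * (2 * real n)"
    using assms(1) by (simp add: s_def field_simps)
  moreover have "fact (2 * Suc k) = real (2 * k + 1) * (2 * real (Suc k) * fact (2 * k))"
    by (simp add: algebra_simps)
  ultimately have "Q (Suc k) * fact (2 * Suc k) = Q k * (2 * real n) * (2 * real (Suc k) * fact (2 * k))"
    by (simp only: flip: mult.assoc)
  also have "\<dots> = Q k * fact (2 * k) * (4 * real n * real (Suc k))" by simp
  also have "\<dots> = Q 0 * (4 * real n) ^ Suc k * fact (Suc k)"
    unfolding Suc.IH by simp
  finally show ?case .
qed simp

lemma pochhammer_divide:
  fixes x c :: "'a::field"
  assumes "c \<noteq> 0"
  shows "pochhammer (x / c) (Suc N) = (\<Prod>i\<le>N. x + c * of_nat i) / c ^ Suc N"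
proof -
  have "pochhammer (x / c) (Suc N) = (\<Prod>i\<le>N. (x + c * of_nat i) / c)"
    using assms by (simp add: pochhammer_Suc_prod atLeast0AtMost field_simps)
  then show ?thesis by (simp add: prod_dividef)
qed

text \<open>Up to a constant, the coefficient of z^(2k) in the N-th approximant. The factor r = 0 is
  left out: by the multiplication formula, the reciprocal Gamma values with r >= 1 then produce the
  Gamma value of the moment itself.\<close>

definition polya_approx_coeff :: "nat \<Rightarrow> nat \<Rightarrow> nat \<Rightarrow> real" where
  "polya_approx_coeff n N k = (-1) ^ k * (real (N choose k) / real N ^ k) * (1 / (4 * real n)) ^ k *
     (\<Prod>r\<in>{1..<n}. rGamma_series (real (2 * k + 1) / real (2 * n) + real r / real n) N)"

lemma polya_approx_coeff_tendsto:
  assumes "n \<ge> 1"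
  obtains C where "\<And>k. (\<lambda>N. C * polya_approx_coeff n N k) \<longlonglongrightarrow> (-1) ^ k * polya_moment n (2 * k) / fact (2 * k)"
proof
  define s where "s = (\<lambda>k. real (2 * k + 1) / real (2 * n))"
  define Q where "Q = (\<lambda>k. \<Prod>r<n. rGamma (s k + real r / real n))"
  define P where "P = (\<lambda>k. \<Prod>r\<in>{1..<n}. rGamma (s k + real r / real n))"
  have s: "s k > 0" for k using assms by (simp add: s_def)
  have nonpole: "s k + y \<notin> \<int>\<^sub>\<le>\<^sub>0" if "y \<ge> 0" for k y
    using that s[of k] by (auto elim!: nonpos_Ints_cases')
  have Q0: "Q 0 \<noteq> 0" using nonpole by (simp add: Q_def rGamma_eq_zero_iff)
  have "{..<n} = insert 0 {1..<n}" using assms by auto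
  then have "Q k = rGamma (s k) * P k" for k by (simp add: Q_def P_def)
  \<comment> \<open>Dividing out the factor r = 0 is legitimate since \<open>s k\<close> is positive
    and hence not a pole of Gamma.\<close>
  then have P: "P k = Gamma (s k) * Q k" for k
    using nonpole[of 0 k] by (simp add: Gamma_def rGamma_eq_zero_iff)
  fix k
  have "(\<lambda>N. 1 / (real n * Q 0) * polya_approx_coeff n N k) \<longlonglongrightarrow>
      1 / (real n * Q 0) * ((-1) ^ k * (1 / fact k) * (1 / (4 * real n)) ^ k * P k)"
    unfolding polya_approx_coeff_def P_def s_def
    by (intro tendsto_intros binomial_div_power_tendsto)
  also have "1 / (real n * Q 0) * ((-1) ^ k * (1 / fact k) * (1 / (4 * real n)) ^ k * P k) =
      (-1) ^ k * polya_moment n (2 * k) / fact (2 * k)"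
  proof -
    have "Q k * fact (2 * k) = Q 0 * (4 * real n) ^ k * fact k"
      using prod_rGamma_arith_progression[OF assms, of k] by (simp add: Q_def s_def)
    then have Qk: "Q k = Q 0 * (4 * real n) ^ k * fact k / fact (2 * k)"
      by (simp add: field_simps)
    show ?thesis
      unfolding P Qk polya_moment_even[OF assms]
      using Q0 assms by (simp add: s_def power_one_over field_simps)
  qed
  finally show "(\<lambda>N. 1 / (real n * Q 0) * polya_approx_coeff n N k) \<longlonglongrightarrow>
      (-1) ^ k * polya_moment n (2 * k) / fact (2 * k)" .
qed

text \<open>For fixed \<open>N\<close>, Euler's quotient at s is s(s+1)...(s+N) / (N! N^s). Since s
  is affine in k, the power of N splits into a constant and a k-th power, leaving factors 2k + a
  with a > 0, as produced by \<open>theta_shift\<close> on z^(2k).\<close>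

lemma prod_rGamma_series:
  fixes n N :: nat
  assumes "n \<ge> 1"
  obtains D \<tau> where "\<tau> > 0" "\<And>k. (\<Prod>r\<in>{1..<n}. rGamma_series (real (2 * k + 1) / real (2 * n) + real r / real n) N) =
     D * \<tau> ^ k * (\<Prod>(r, i)\<in>{1..<n} \<times> {..N}. real (2 * k) + real (1 + 2 * r + 2 * n * i))"
proof
  let ?L = "ln (real N) / real n"
  define d where "d = (\<lambda>r. 1 / ((2 * real n) ^ Suc N * fact N * exp ((1 / 2 + real r) * ?L)))"
  \<comment> \<open>This is the witness for \<open>\<tau>\<close>: each of the n - 1 quotients
    contributes one factor N^(-1/n) per unit of k.\<close>
  show "exp (- ?L) ^ (n - 1) > 0" by simp
  fix k
  have "rGamma_series (real (2 * k + 1) / real (2 * n) + real r / real n) N =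
      d r * exp (- ?L) ^ k * (\<Prod>i\<le>N. real (2 * k) + real (1 + 2 * r + 2 * n * i))" for r
  proof -
    have eq: "real (2 * k + 1) / real (2 * n) + real r / real n = real (2 * k + 1 + 2 * r) / (2 * real n)"
      using assms by (simp add: field_simps)
    have "pochhammer (real (2 * k + 1 + 2 * r) / (2 * real n)) (Suc N) =
        (\<Prod>i\<le>N. real (2 * k) + real (1 + 2 * r + 2 * n * i)) / (2 * real n) ^ Suc N"
      using assms by (subst pochhammer_divide) (auto simp: algebra_simps)
    moreover have "exp (real (2 * k + 1 + 2 * r) / (2 * real n) * ln (real N)) =
        exp ((1 / 2 + real r) * ?L) * exp ?L ^ k"
      using assms by (simp add: field_simps flip: exp_of_nat_mult exp_add)
    ultimately show ?thesis
      unfolding eq rGamma_series_def by (simp add: d_def exp_minus field_simps)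
  qed
  then show "(\<Prod>r\<in>{1..<n}. rGamma_series (real (2 * k + 1) / real (2 * n) + real r / real n) N) =
     (\<Prod>r\<in>{1..<n}. d r) * (exp (- ?L) ^ (n - 1)) ^ k * (\<Prod>(r, i)\<in>{1..<n} \<times> {..N}. real (2 * k) + real (1 + 2 * r + 2 * n * i))"
    by (simp add: prod.distrib prod.cartesian_product mult.commute flip: power_mult)
qed

text \<open>The coefficients are those of (1 - \<sigma> z^2)^N multiplied by a constant and by
  products of factors j + a with a > 0.\<close>

lemma polya_approx_real_rooted:
  assumes "n \<ge> 1"
  shows "\<exists>p. real_rooted p \<and> (\<forall>j. coeff p j = (if even j then of_real (polya_approx_coeff n N (j div 2)) else 0))"
proof -
  obtain D \<tau> where "\<tau> > 0" and D: "\<And>k. (\<Prod>r\<in>{1..<n}. rGamma_series (real (2 * k + 1) / real (2 * n) + real r / real n) N) =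
     D * \<tau> ^ k * (\<Prod>(r, i)\<in>{1..<n} \<times> {..N}. real (2 * k) + real (1 + 2 * r + 2 * n * i))"
    using prod_rGamma_series[OF assms] by blast
  \<comment> \<open>This scale absorbs all k-th powers other than the sign. For N = 0, division by
    zero gives \<sigma> = 0, which is consistent because then \<open>q\<close> is 1.\<close>
  define \<sigma> where "\<sigma> = \<tau> / (4 * real n * real N)"
  define q where "q = [:1, 0, - complex_of_real \<sigma>:] ^ N"
  define m where "m = (\<lambda>j. \<Prod>(r, i)\<in>{1..<n} \<times> {..N}. real j + real (1 + 2 * r + 2 * n * i))"
  have "\<sigma> \<ge> 0" using \<open>\<tau> > 0\<close> by (simp add: \<sigma>_def)
  then have "\<exists>p. real_rooted p \<and> (\<forall>j. coeff p j = of_real (m j) * coeff q j)"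
    unfolding m_def q_def case_prod_unfold
    by (intro real_rooted_multiplier real_rooted_even_power) (auto intro!: add_pos_nonneg)
  then obtain p where p: "real_rooted p" "\<And>j. coeff p j = of_real (m j) * coeff q j" by blast
  have "coeff (smult (of_real D) p) j = (if even j then of_real (polya_approx_coeff n N (j div 2)) else 0)" for j
  proof (cases "even j")
    case True
    then obtain k where j: "j = 2 * k" by (elim evenE)
    have "D * (m (2 * k) * (real (N choose k) * (- \<sigma>) ^ k)) = polya_approx_coeff n N k"
      unfolding polya_approx_coeff_def D \<sigma>_def m_def
      by (simp add: power_divide power_mult_distrib power_minus[of "_ / _"] field_simps)
    from arg_cong[OF this, of complex_of_real] show ?thesis
      unfolding coeff_smult p(2) q_def coeff_even_power by (simp add: j)
  next
    case False
    then show ?thesis by (simp add: p q_def coeff_even_power)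
  qed
  then show ?thesis using real_rooted_smult[OF p(1)] by blast
qed

lemma polya_F_real_rooted_limit:
  assumes "n \<ge> 1"
  obtains p where "real_rooted_limit p (polya_coeff n) (polya_F (2 * n))"
proof -
  obtain C where C: "\<And>k. (\<lambda>N. C * polya_approx_coeff n N k) \<longlonglongrightarrow> (-1) ^ k * polya_moment n (2 * k) / fact (2 * k)"
    using polya_approx_coeff_tendsto[OF assms] by blast
  obtain p where p: "\<And>N. real_rooted (p N)"
    "\<And>N j. coeff (p N) j = (if even j then of_real (polya_approx_coeff n N (j div 2)) else 0)"
    using polya_approx_real_rooted[OF assms] by metis
  have "real_rooted_limit (\<lambda>N. smult (of_real C) (p N)) (polya_coeff n) (polya_F (2 * n))"
  proof
    show "real_rooted (smult (of_real C) (p N))" for N by (rule real_rooted_smult[OF p(1)])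
    show "(\<lambda>N. coeff (smult (of_real C) (p N)) j) \<longlonglongrightarrow> polya_coeff n j" for j
    proof (cases "even j")
      case True
      then obtain k where j: "j = 2 * k" by (elim evenE)
      have "polya_coeff n j = of_real ((-1) ^ k * polya_moment n (2 * k) / fact (2 * k))"
        by (simp add: j polya_coeff_def power_mult)
      then show ?thesis
        using tendsto_of_real[OF C[of k], where ?'a = complex] by (simp add: p j)
    next
      case False
      then show ?thesis by (simp add: p polya_coeff_def polya_moment_odd)
    qed
    show "polya_coeff n 0 \<noteq> 0"
      using polya_moment_0_pos[OF assms] by (simp add: polya_coeff_def)
    show "(\<lambda>j. polya_coeff n j * z ^ j) sums polya_F (2 * n) z" for z
      by (rule polya_F_sums[OF assms])
  qed
  then show ?thesis by (rule that)
qed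

theorem mainTheorem1:
  fixes n :: nat and z0 :: complex
  assumes "n \<ge> 1"
    and "polya_F (2 * n) z0 = 0"
  shows "deriv (polya_F (2 * n)) z0 \<noteq> 0"
proof -
  obtain p where "real_rooted_limit p (polya_coeff n) (polya_F (2 * n))"
    using polya_F_real_rooted_limit[OF assms(1)] by blast
  then interpret real_rooted_limit p "polya_coeff n" "polya_F (2 * n)" .
  show ?thesis
  proof (rule simple_zeros)
    \<comment> \<open>The truncated subtractions are exact because n >= 1; for n = 1 the equation
      has order 1.\<close>
    have "Suc (2 * n - 2) = 2 * n - 1" using assms(1) by simp
    then show "(deriv ^^ Suc (2 * n - 2)) (polya_F (2 * n)) z =
        (-1) ^ n / of_nat (2 * n) * (z * polya_F (2 * n) z)" for z
      using polya_F_ode[OF assms(1)] by simp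
  qed (use assms in auto)
qed

end
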